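(* Let $\mathcal H_B,\mathcal H_A,\mathcal H_E,\mathcal H_X$ be finite-dimensional complex Hilbert spaces (battery, auxiliary, environment, external), let $H_B$ be a Hermitian operator on $\mathcal H_B$, let $\rho^2_{BAE}$ be a density operator on $\mathcal H_B\otimes\mathcal H_A\otimes\mathcal H_E$, let $\rho_X$ be a density operator on $\mathcal H_X$, and let the state of the whole system be $\rho^2_S=\rho^2_{BAE}\otimes\rho_X$. Put $$\rho_B=\operatorname{tr}_{AE}[\rho^2_{BAE}],\qquad Z'=\operatorname{tr}[\rho_BH_B]\,\mathbb I_{BAE}-H_B\otimes\mathbb I_{AE},\qquad \mathcal B'=\operatorname{tr}_B\big[\rho^2_{BAE}\,Z'\big],$$ and let $\{\beta'_i\}_i$ be the eigenvalues of the operator $\mathcal B'$ on $\mathcal H_A\otimes\mathcal H_E$. Then the distillable energy $S^{NP_1}_D$, the maximum stochastically extractable energy $S^{NP_1}_{\max}$ and the average extractable energy $S^{NP_1}_{av}$ obtained by performing the optimal type-1 NPOVM on the auxiliary (realized by a projective measurement on $AE$) are $$S^{NP_1}_D=\sum_{i\in\mathcal I}\beta'_i,\qquad S^{NP_1}_{\max}=\max_i\beta'_i,\qquad S^{NP_1}_{av}=\sum_i\beta'_i,$$ where $\mathcal I=\{i:\beta'_i>0\}$ is the set of indices of the positive eigenvalues.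
   Context: Eigenvalues are listed with multiplicity; an empty sum is $0$. A type-1 NPOVM (non-positive operator-valued measurement) on the auxiliary $A$ is implemented by a rank-one projective measurement on $AE$, where $A$ and $E$ may be entangled, i.e. by an orthonormal basis $\Psi=\{|\Psi_i\rangle\}_i$ of $\mathcal H_A\otimes\mathcal H_E$. For outcome $i$, the unnormalized post-measurement state is $$\rho'^{\,3,i}_{BAE}=(\mathbb I_B\otimes|\Psi_i\rangle\langle\Psi_i|)\,\rho^2_{BAE}\,(\mathbb I_B\otimes|\Psi_i\rangle\langle\Psi_i|),$$ its probability is $p'_i=\operatorname{tr}(\rho'^{\,3,i}_{BAE})$, and the energy extracted from the battery, weighted by the probability, is $$s'_i(\Psi)=p'_i\operatorname{tr}[\rho_BH_B]-\operatorname{tr}\big[H_B\operatorname{tr}_{AE}(\rho'^{\,3,i}_{BAE})\big].$$ The three figures of merit are: - distillable energy: $S^{NP_1}_D=\max_{\Psi}\sum_{i:\,s'_i(\Psi)>0}s'_i(\Psi)$; - maximum stochastically extractable energy: $S^{NP_1}_{\max}=\max_{\Psi}\max_i s'_i(\Psi)$; - average extractable energy: $S^{NP_1}_{av}=\max_\Psi\sum_i s'_i(\Psi)$; where all maxima over $\Psi$ run over all orthonormal bases of $\mathcal H_A\otimes\mathcal H_E$. *)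

theory Defs
  imports "HOL-Analysis.Analysis" "HOL-Computational_Algebra.Polynomial"
begin

text \<open>
  A Hilbert space of dimension n is modelled as \<open>complex ^ 'n\<close> with \<open>CARD('n) = n\<close>, and operators
  as square matrices. The tensor product of \<open>complex ^ 'm\<close> and \<open>complex ^ 'n\<close> is
  \<open>complex ^ ('m \<times> 'n)\<close>; the composite space of B, A and E uses the index type
  \<open>'b \<times> ('a \<times> 'e)\<close>.
\<close>

definition cinner :: "complex ^ 'n \<Rightarrow> complex ^ 'n \<Rightarrow> complex" where
  "cinner u v = (\<Sum>i\<in>UNIV. cnj (u $ i) * v $ i)"

definition adj :: "complex ^ 'n ^ 'm \<Rightarrow> complex ^ 'm ^ 'n" where
  "adj M = (\<chi> i j. cnj (M $ j $ i))"

definition hermitian :: "complex ^ 'n ^ 'n \<Rightarrow> bool" where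
  "hermitian M \<longleftrightarrow> adj M = M"

definition density_op :: "complex ^ 'n ^ 'n \<Rightarrow> bool" where
  "density_op \<rho> \<longleftrightarrow>
     hermitian \<rho> \<and> (\<forall>v. 0 \<le> Re (cinner v (\<rho> *v v))) \<and> trace \<rho> = 1"

definition tensor ::
  "complex ^ 'm ^ 'm \<Rightarrow> complex ^ 'n ^ 'n \<Rightarrow> complex ^ ('m \<times> 'n) ^ ('m \<times> 'n)"
  (infixl \<open>\<otimes>\<^sub>m\<close> 72) where
  "M \<otimes>\<^sub>m N = (\<chi> p q. M $ fst p $ fst q * N $ snd p $ snd q)"

text \<open>Partial trace over the first, respectively the second tensor factor.\<close>

definition ptrace_fst :: "complex ^ ('m::finite \<times> 'n::finite) ^ ('m \<times> 'n) \<Rightarrow> complex ^ 'n ^ 'n" where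
  "ptrace_fst M = (\<chi> i j. \<Sum>k\<in>UNIV. M $ (k, i) $ (k, j))"

definition ptrace_snd :: "complex ^ ('m::finite \<times> 'n::finite) ^ ('m \<times> 'n) \<Rightarrow> complex ^ 'm ^ 'm" where
  "ptrace_snd M = (\<chi> i j. \<Sum>k\<in>UNIV. M $ (i, k) $ (j, k))"

definition charpoly :: "complex ^ 'n ^ 'n \<Rightarrow> complex poly" where
  "charpoly M = det (\<chi> i j. (if i = j then [:0, 1:] else 0) - [:M $ i $ j:])"

text \<open>The eigenvalues of a matrix, repeated according to (algebraic) multiplicity.\<close>

definition eigenvalues :: "complex ^ 'n ^ 'n \<Rightarrow> complex multiset" where
  "eigenvalues M = proots (charpoly M)"

definition orthonormal_basis :: "('n \<Rightarrow> complex ^ 'n) \<Rightarrow> bool" where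
  "orthonormal_basis \<Psi> \<longleftrightarrow>
     (\<forall>i j. cinner (\<Psi> i) (\<Psi> j) = (if i = j then 1 else 0)) \<and> vec.span (range \<Psi>) = UNIV"

text \<open>The operator \<open>|v\<rangle>\<langle>v|\<close>.\<close>

definition ketbra :: "complex ^ 'n \<Rightarrow> complex ^ 'n ^ 'n" where
  "ketbra v = (\<chi> i j. v $ i * cnj (v $ j))"

text \<open>In what follows \<open>H\<close> is the battery Hamiltonian and \<open>\<rho>\<close> the state of BAE.\<close>

definition Z_op ::
  "complex ^ 'b ^ 'b \<Rightarrow> complex ^ ('b::finite \<times> 'a::finite \<times> 'e::finite) ^ ('b \<times> 'a \<times> 'e)
     \<Rightarrow> complex ^ ('b \<times> 'a \<times> 'e) ^ ('b \<times> 'a \<times> 'e)" where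
  "Z_op H \<rho> = mat (trace (ptrace_snd \<rho> ** H)) - H \<otimes>\<^sub>m mat 1"

definition B_op ::
  "complex ^ 'b ^ 'b \<Rightarrow> complex ^ ('b::finite \<times> 'a::finite \<times> 'e::finite) ^ ('b \<times> 'a \<times> 'e)
     \<Rightarrow> complex ^ ('a \<times> 'e) ^ ('a \<times> 'e)" where
  "B_op H \<rho> = ptrace_fst (\<rho> ** Z_op H \<rho>)"

text \<open>Unnormalized state of BAE after the outcome with measurement vector \<open>v\<close> on AE.\<close>

definition post_state ::
  "complex ^ ('b::finite \<times> 'a::finite \<times> 'e::finite) ^ ('b \<times> 'a \<times> 'e) \<Rightarrow> complex ^ ('a \<times> 'e)
     \<Rightarrow> complex ^ ('b \<times> 'a \<times> 'e) ^ ('b \<times> 'a \<times> 'e)" where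
  "post_state \<rho> v = (mat 1 \<otimes>\<^sub>m ketbra v) ** \<rho> ** (mat 1 \<otimes>\<^sub>m ketbra v)"

definition outcome_energy_complex ::
  "complex ^ 'b ^ 'b \<Rightarrow> complex ^ ('b::finite \<times> 'a::finite \<times> 'e::finite) ^ ('b \<times> 'a \<times> 'e)
     \<Rightarrow> complex ^ ('a \<times> 'e) \<Rightarrow> complex" where
  "outcome_energy_complex H \<rho> v =
     trace (post_state \<rho> v) * trace (ptrace_snd \<rho> ** H)
       - trace (H ** ptrace_snd (post_state \<rho> v))"

text \<open>
  Traces are complex numbers by type; for Hermitian \<open>H\<close> and \<open>\<rho>\<close> the quantity above is real
  (lemma \<open>outcome_energy_complex_real\<close> below), so taking the real part only changes the type.
\<close>

definition outcome_energy ::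
  "complex ^ 'b ^ 'b \<Rightarrow> complex ^ ('b::finite \<times> 'a::finite \<times> 'e::finite) ^ ('b \<times> 'a \<times> 'e)
     \<Rightarrow> complex ^ ('a \<times> 'e) \<Rightarrow> real" where
  "outcome_energy H \<rho> v = Re (outcome_energy_complex H \<rho> v)"

text \<open>
  For each figure of merit, the set of values it takes over all measurement bases. The figure itself
  is the greatest element of that set; since \<^const>\<open>Greatest\<close> is only meaningful if such an element
  exists, attainment has to be asserted separately via \<open>attains_max\<close>.
\<close>

definition attains_max :: "real set \<Rightarrow> bool" where
  "attains_max X \<longleftrightarrow> (\<exists>m\<in>X. \<forall>x\<in>X. x \<le> m)"

definition distillable_values ::
  "complex ^ 'b ^ 'b \<Rightarrow> complex ^ ('b::finite \<times> 'a::finite \<times> 'e::finite) ^ ('b \<times> 'a \<times> 'e) \<Rightarrow> real set" where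
  "distillable_values H \<rho> =
     {(\<Sum>i | outcome_energy H \<rho> (\<Psi> i) > 0. outcome_energy H \<rho> (\<Psi> i)) | \<Psi>. orthonormal_basis \<Psi>}"

definition stochastic_values ::
  "complex ^ 'b ^ 'b \<Rightarrow> complex ^ ('b::finite \<times> 'a::finite \<times> 'e::finite) ^ ('b \<times> 'a \<times> 'e) \<Rightarrow> real set" where
  "stochastic_values H \<rho> =
     {Max (range (\<lambda>i. outcome_energy H \<rho> (\<Psi> i))) | \<Psi>. orthonormal_basis \<Psi>}"

definition average_values ::
  "complex ^ 'b ^ 'b \<Rightarrow> complex ^ ('b::finite \<times> 'a::finite \<times> 'e::finite) ^ ('b \<times> 'a \<times> 'e) \<Rightarrow> real set" where
  "average_values H \<rho> =
     {(\<Sum>i\<in>UNIV. outcome_energy H \<rho> (\<Psi> i)) | \<Psi>. orthonormal_basis \<Psi>}"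

definition S_D ::
  "complex ^ 'b ^ 'b \<Rightarrow> complex ^ ('b::finite \<times> 'a::finite \<times> 'e::finite) ^ ('b \<times> 'a \<times> 'e) \<Rightarrow> real" where
  "S_D H \<rho> = (GREATEST s. s \<in> distillable_values H \<rho>)"

definition S_max ::
  "complex ^ 'b ^ 'b \<Rightarrow> complex ^ ('b::finite \<times> 'a::finite \<times> 'e::finite) ^ ('b \<times> 'a \<times> 'e) \<Rightarrow> real" where
  "S_max H \<rho> = (GREATEST s. s \<in> stochastic_values H \<rho>)"

definition S_av ::
  "complex ^ 'b ^ 'b \<Rightarrow> complex ^ ('b::finite \<times> 'a::finite \<times> 'e::finite) ^ ('b \<times> 'a \<times> 'e) \<Rightarrow> real" where
  "S_av H \<rho> = (GREATEST s. s \<in> average_values H \<rho>)"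

lemma adj_mult: "adj (M ** N) = adj N ** adj M"
  by (simp add: adj_def matrix_matrix_mult_def vec_eq_iff mult.commute)

lemma trace_adj: "trace (adj M) = cnj (trace M)"
  by (simp add: adj_def trace_def)

lemma trace_mult_real:
  assumes "hermitian M" "hermitian N"
  shows "trace (M ** N) \<in> \<real>"
proof -
  have "cnj (trace (M ** N)) = trace (M ** N)"
    using assms by (metis adj_mult hermitian_def trace_adj trace_mul_sym)
  then show ?thesis
    by (simp add: Reals_cnj_iff)
qed

lemma adj_ptrace_snd: "adj (ptrace_snd M) = ptrace_snd (adj M)"
  by (simp add: adj_def ptrace_snd_def vec_eq_iff)

lemma adj_tensor_ketbra: "adj (mat 1 \<otimes>\<^sub>m ketbra v) = mat 1 \<otimes>\<^sub>m ketbra v"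
  by (auto simp add: adj_def tensor_def ketbra_def mat_def vec_eq_iff mult.commute)

lemma hermitian_post_state:
  assumes "hermitian \<rho>"
  shows "hermitian (post_state \<rho> v)"
  using assms by (simp add: hermitian_def post_state_def adj_mult adj_tensor_ketbra matrix_mul_assoc)

lemma outcome_energy_complex_real:
  assumes "hermitian H" "hermitian \<rho>"
  shows "outcome_energy_complex H \<rho> v \<in> \<real>"
proof -
  have "hermitian (ptrace_snd \<rho>)" "hermitian (ptrace_snd (post_state \<rho> v))"
    using assms hermitian_post_state[of \<rho> v] by (simp_all add: hermitian_def adj_ptrace_snd)
  moreover have "trace (post_state \<rho> v) \<in> \<real>"
    using trace_adj[of "post_state \<rho> v"] hermitian_post_state[OF assms(2), of v]
    by (simp add: hermitian_def Reals_cnj_iff)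
  ultimately show ?thesis
    unfolding outcome_energy_complex_def
    using trace_mult_real assms(1) by (intro Reals_diff Reals_mult) auto
qed

end

theory Submission imports Defs begin

text \<open>
  By cyclicity of the trace, the weighted energy of the outcome with unit vector \<open>v\<close> is the
  expectation value of the Hermitian operator \<open>\<B>'\<close> in \<open>v\<close>. Expanding in an orthonormal eigenbasis
  \<open>\<phi>\<close> of \<open>\<B>'\<close> with eigenvalues \<open>\<beta>\<close>, the energies of a basis \<open>\<psi>\<close> are the averages of \<open>\<beta>\<close> with the
  weights \<open>\<bar>\<langle>\<phi>\<^sub>j, \<psi>\<^sub>i\<rangle>\<bar>\<^sup>2\<close>, which form a doubly stochastic matrix. This bounds all three figures of
  merit, and measuring in the basis \<open>\<phi>\<close> attains the bounds.
\<close>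

subsection \<open>The Hermitian inner product\<close>

lemma cinner_add_left: "cinner (u + v) w = cinner u w + cinner v w"
  by (simp add: cinner_def algebra_simps sum.distrib)

lemma cinner_add_right: "cinner w (u + v) = cinner w u + cinner w v"
  by (simp add: cinner_def algebra_simps sum.distrib)

lemma cinner_diff_right: "cinner w (u - v) = cinner w u - cinner w v"
  by (simp add: cinner_def algebra_simps sum_subtractf)

lemma cinner_scale_left: "cinner (c *s u) v = cnj c * cinner u v"
  by (simp add: cinner_def sum_distrib_left mult.assoc)

lemma cinner_scale_right: "cinner u (c *s v) = c * cinner u v"
  by (simp add: cinner_def sum_distrib_left mult.left_commute)

lemma cnj_cinner: "cnj (cinner u v) = cinner v u"
  by (simp add: cinner_def mult.commute)

lemma cinner_self: "cinner v v = of_real ((norm v)\<^sup>2)"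
  by (simp add: cinner_def norm_vec_def L2_set_def sum_nonneg complex_norm_square mult.commute
      del: of_real_power)

lemma norm_scale: "norm (c *s v) = cmod c * norm (v :: complex ^ 'n)"
  by (simp add: norm_vec_def norm_mult L2_set_right_distrib)

lemma cinner_matrix_adj: "cinner u (M *v w) = cinner (adj M *v u) w"
  unfolding cinner_def adj_def matrix_vector_mult_def
  by (simp add: sum_distrib_left sum_distrib_right, subst sum.swap) (simp add: ac_simps)

lemma continuous_on_cinner [continuous_intros]:
  fixes f g :: "'t::topological_space \<Rightarrow> complex ^ 'n"
  assumes "continuous_on S f" "continuous_on S g"
  shows "continuous_on S (\<lambda>x. cinner (f x) (g x))"
  unfolding cinner_def using assms by (intro continuous_intros)

lemma hermitian_cinner:
  assumes "hermitian M"
  shows "cinner u (M *v v) = cinner (M *v u) v"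
  using assms by (simp add: cinner_matrix_adj hermitian_def)

lemma hermitian_expectation_real:
  assumes "hermitian M"
  shows "cinner v (M *v v) \<in> \<real>"
  by (metis Reals_cnj_iff assms cnj_cinner hermitian_cinner)

subsection \<open>Orthonormal bases\<close>

text \<open>The matrix \<open>U\<close> has the basis vectors as columns, so its Gram matrix is
  \<open>adj U ** U\<close>. Since \<open>U\<close> is square, this one-sided inverse is two-sided,
  which yields the completeness relation from orthonormality alone.\<close>

lemma orthonormal_resolution:
  fixes \<phi> :: "'n::finite \<Rightarrow> complex ^ 'n"
  assumes "\<And>i j. cinner (\<phi> i) (\<phi> j) = (if i = j then 1 else 0)"
  defines "U \<equiv> (\<chi> r i. \<phi> i $ r)"
  shows "adj U ** U = mat 1" "U ** adj U = mat 1"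
proof -
  show *: "adj U ** U = mat 1"
    using assms(1) by (simp add: U_def adj_def matrix_matrix_mult_def mat_def vec_eq_iff cinner_def)
  then show "U ** adj U = mat 1"
    by (simp add: matrix_left_right_inverse)
qed

text \<open>Inserting the completeness relation \<open>U ** adj U = mat 1\<close> between
  \<open>u\<close> and \<open>v\<close>.\<close>

lemma orthonormal_parseval:
  fixes \<phi> :: "'n::finite \<Rightarrow> complex ^ 'n"
  assumes "\<And>i j. cinner (\<phi> i) (\<phi> j) = (if i = j then 1 else 0)"
  shows "(\<Sum>i\<in>UNIV. cnj (cinner (\<phi> i) u) * cinner (\<phi> i) v) = cinner u v"
proof -
  define U where "U = (\<chi> r i. \<phi> i $ r)"
  have c: "cinner (\<phi> i) w = (adj U *v w) $ i" for i w
    by (simp add: U_def adj_def matrix_vector_mult_def cinner_def)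
  have "(\<Sum>i\<in>UNIV. cnj (cinner (\<phi> i) u) * cinner (\<phi> i) v) = cinner (adj U *v u) (adj U *v v)"
    by (simp only: c cinner_def[of "adj U *v u"])
  also have "\<dots> = cinner u ((U ** adj U) *v v)"
    by (simp add: cinner_matrix_adj[of _ U] matrix_vector_mul_assoc[symmetric])
  also have "\<dots> = cinner u v"
    using orthonormal_resolution(2)[OF assms] by (simp add: U_def)
  finally show ?thesis .
qed

text \<open>As many orthonormal vectors as the dimension span the space:
  \<open>U *v (adj U *v v)\<close> is the expansion of \<open>v\<close> in them.\<close>

lemma orthonormal_basisI:
  fixes \<phi> :: "'n::finite \<Rightarrow> complex ^ 'n"
  assumes "\<And>i j. cinner (\<phi> i) (\<phi> j) = (if i = j then 1 else 0)"
  shows "orthonormal_basis \<phi>"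
proof -
  define U where "U = (\<chi> r i. \<phi> i $ r)"
  have "v \<in> vec.span (range \<phi>)" for v
  proof -
    have "v = U *v (adj U *v v)"
      using orthonormal_resolution(2)[OF assms] by (simp add: U_def matrix_vector_mul_assoc)
    also have "\<dots> = (\<Sum>i\<in>UNIV. (adj U *v v) $ i *s \<phi> i)"
      by (simp add: U_def matrix_vector_mult_def vec_eq_iff mult.commute)
    finally show ?thesis
      by (metis (no_types, lifting) rangeI vec.span_base vec.span_scale vec.span_sum)
  qed
  then show ?thesis
    using assms by (auto simp: orthonormal_basis_def)
qed

lemma orthonormal_basis_self:
  assumes "orthonormal_basis \<phi>"
  shows "cinner (\<phi> i) (\<phi> i) = 1"
  using assms unfolding orthonormal_basis_def by metis

lemma orthonormal_cmod_sum:
  fixes \<phi> :: "'n::finite \<Rightarrow> complex ^ 'n"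
  assumes "orthonormal_basis \<phi>" "cinner v v = 1"
  shows "(\<Sum>i\<in>UNIV. (cmod (cinner (\<phi> i) v))\<^sup>2) = 1"
proof -
  have "complex_of_real (\<Sum>i\<in>UNIV. (cmod (cinner (\<phi> i) v))\<^sup>2)
      = (\<Sum>i\<in>UNIV. cnj (cinner (\<phi> i) v) * cinner (\<phi> i) v)"
    by (simp add: complex_norm_square mult.commute del: of_real_power)
  also have "\<dots> = 1"
    using assms orthonormal_parseval[of \<phi> v v] by (simp add: orthonormal_basis_def)
  finally show ?thesis
    using of_real_eq_1_iff by blast
qed

subsection \<open>The spectral theorem\<close>

text \<open>The orthogonality constraints form a square system whose row \<open>k\<close> is zero.
  Its determinant vanishes, so a nonzero solution exists and can be normalized.\<close>

lemma exists_unit_orthogonal: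
  fixes \<phi> :: "'n::finite \<Rightarrow> complex ^ 'n"
  assumes "k \<notin> I"
  shows "\<exists>v. norm v = 1 \<and> (\<forall>i\<in>I. cinner (\<phi> i) v = 0)"
proof -
  define A :: "complex ^ 'n ^ 'n" where "A = (\<chi> i j. if i \<in> I then cnj (\<phi> i $ j) else 0)"
  have "row k A = 0"
    using assms by (simp add: A_def row_def vec_eq_iff)
  then have "det A = 0"
    by (simp add: det_zero_row)
  then have "\<not> invertible A"
    by (simp add: invertible_det_nz)
  then obtain v where v: "A *v v = 0" "v \<noteq> 0"
    using invertible_left_inverse matrix_left_invertible_ker by blast
  have o: "cinner (\<phi> i) v = 0" if "i \<in> I" for i
  proof -
    have "cinner (\<phi> i) v = (A *v v) $ i"
      using that by (simp add: A_def matrix_vector_mult_def cinner_def)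
    then show ?thesis using v by simp
  qed
  define w where "w = complex_of_real (inverse (norm v)) *s v"
  have "norm w = 1"
    using v(2) by (simp add: w_def norm_scale norm_inverse)
  then show ?thesis
    using o by (intro exI[of _ w]) (simp add: w_def cinner_scale_right)
qed

text \<open>The first-order condition at the minimum \<open>t = 0\<close>, phrased without
  derivatives.\<close>

lemma quadratic_nonneg_linear_zero:
  fixes a b :: real
  assumes "\<And>t. a * t\<^sup>2 + 2 * b * t \<ge> 0"
  shows "b = 0"
proof (rule ccontr)
  assume "b \<noteq> 0"
  \<comment> \<open>At \<open>t = - b / m\<close> with \<open>m > 0\<close> and
    \<open>m > a\<close>, the linear term outweighs the quadratic one and the value is
    negative.\<close>
  define m where "m = \<bar>a\<bar> + 1"
  have m: "m > 0" "a < m" by (auto simp: m_def)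
  have "a * (- b / m)\<^sup>2 + 2 * b * (- b / m) = (b\<^sup>2 / m) * (a / m - 2)"
    using m(1) by (simp add: field_simps power2_eq_square)
  moreover have "a / m < 1" using m by simp
  moreover have "b\<^sup>2 / m > 0" using m \<open>b \<noteq> 0\<close> by simp
  ultimately have "a * (- b / m)\<^sup>2 + 2 * b * (- b / m) < 0"
    using mult_pos_neg[of "b\<^sup>2 / m" "a / m - 2"] by linarith
  then show False using assms[of "- b / m"] by linarith
qed

text \<open>
  A maximizer \<open>v\<close> of the quadratic form on the unit sphere of the orthogonal complement is an
  eigenvector: the first variation in the direction \<open>M v - \<lambda> v\<close> is \<open>norm (M v - \<lambda> v)\<^sup>2\<close>, up to sign.
\<close>

lemma hermitian_eigenvector_orthogonal:
  fixes M :: "complex ^ 'n::finite ^ 'n" and I :: "'n set"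
  assumes M: "hermitian M" and k: "k \<notin> I"
    and eig: "\<And>i. i \<in> I \<Longrightarrow> M *v \<phi> i = complex_of_real (\<mu> i) *s \<phi> i"
  shows "\<exists>v l. cinner v v = 1 \<and> (\<forall>i\<in>I. cinner (\<phi> i) v = 0) \<and> M *v v = complex_of_real l *s v"
proof -
  define q where "q v = Re (cinner v (M *v v))" for v
  define W where "W = {v. \<forall>i\<in>I. cinner (\<phi> i) v = 0}"
  define S where "S = W \<inter> sphere 0 1"
  have W: "u + v \<in> W" "c *s u \<in> W" "u - v \<in> W" if "u \<in> W" "v \<in> W" for u v c
    using that by (simp_all add: W_def cinner_add_right cinner_scale_right cinner_diff_right)
  \<comment> \<open>Hermiticity moves \<open>M\<close> onto \<open>\<phi> i\<close>, where it acts
    as a scalar, so \<open>W\<close> is invariant under \<open>M\<close>.\<close>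
  have MW: "M *v v \<in> W" if "v \<in> W" for v
    using that eig by (simp add: W_def hermitian_cinner[OF M] cinner_scale_left)
  have "W = (\<Inter>i\<in>I. {v. cinner (\<phi> i) v = 0})"
    by (auto simp: W_def)
  moreover have "closed \<dots>"
    by (intro closed_INT ballI closed_Collect_eq continuous_intros)
  ultimately have "compact S"
    unfolding S_def by (simp add: closed_Int_compact)
  moreover have "S \<noteq> {}"
    using exists_unit_orthogonal[OF k, of \<phi>] by (auto simp: S_def W_def)
  moreover have "continuous_on S q"
    unfolding q_def by (intro continuous_intros matrix_vector_mult_linear_continuous_on)
  ultimately obtain v where v: "v \<in> S" and max: "\<And>w. w \<in> S \<Longrightarrow> q w \<le> q v"
    using continuous_attains_sup by metis
  define l where "l = q v"
  have vv: "cinner v v = 1" "v \<in> W"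
    using v by (auto simp: S_def cinner_self)
  have q_scale: "q (complex_of_real t *s w) = t\<^sup>2 * q w" for t w
    by (simp add: q_def vec.scale cinner_scale_left cinner_scale_right power2_eq_square)
  \<comment> \<open>Homogeneity of degree two extends the maximum on the unit sphere to all of
    \<open>W\<close>.\<close>
  have bound: "q w \<le> l * (norm w)\<^sup>2" if w: "w \<in> W" for w
  proof (cases "w = 0")
    case True
    then show ?thesis by (simp add: q_def cinner_self)
  next
    case False
    define u where "u = complex_of_real (inverse (norm w)) *s w"
    have "norm u = 1"
      using False by (simp add: u_def norm_scale norm_inverse)
    then have "u \<in> S" using W(2)[OF w w] by (simp add: S_def u_def)
    then have "inverse ((norm w)\<^sup>2) * q w \<le> l"
      using max[of u] unfolding u_def q_scale by (simp add: l_def power_inverse)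
    then show ?thesis using False by (simp add: field_simps)
  qed
  define r where "r = M *v v - complex_of_real l *s v"
  have r: "r \<in> W" using vv W MW by (simp add: r_def)
  \<comment> \<open>This is \<open>bound\<close> at \<open>v + t r\<close>. The constant terms and
    the terms with \<open>Re (cinner r v)\<close> cancel, leaving \<open>- (norm r)\<^sup>2\<close>
    as half the linear coefficient.\<close>
  have "(l * (norm r)\<^sup>2 - q r) * t\<^sup>2 + 2 * (- (norm r)\<^sup>2) * t \<ge> 0" for t
  proof -
    define w where "w = v + complex_of_real t *s r"
    have "M *v v = r + complex_of_real l *s v"
      by (simp add: r_def)
    then have rr: "Re (cinner r (M *v v)) = (norm r)\<^sup>2 + l * Re (cinner r v)"
      by (simp add: cinner_add_right cinner_scale_right cinner_self)
    have "Re (cinner v (M *v r)) = Re (cinner r (M *v v))"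
      using cnj_cinner[of r "M *v v"] by (simp add: hermitian_cinner[OF M] complex_eq_iff)
    then have qw: "q w = l + 2 * t * Re (cinner r (M *v v)) + t\<^sup>2 * q r"
      by (simp add: w_def q_def l_def vec.scale cinner_add_left
          cinner_add_right cinner_scale_left cinner_scale_right power2_eq_square algebra_simps)
    have "Re (cinner v r) = Re (cinner r v)"
      using cnj_cinner[of r v] by (simp add: complex_eq_iff)
    then have "Re (cinner w w) = 1 + 2 * t * Re (cinner r v) + t\<^sup>2 * Re (cinner r r)"
      by (simp add: w_def vv cinner_add_left
          cinner_add_right cinner_scale_left cinner_scale_right power2_eq_square algebra_simps)
    then have nw: "(norm w)\<^sup>2 = 1 + 2 * t * Re (cinner r v) + t\<^sup>2 * (norm r)\<^sup>2"
      by (simp add: cinner_self)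
    have "w \<in> W" using vv r W by (simp add: w_def)
    from bound[OF this] show ?thesis
      unfolding qw nw rr by (simp add: algebra_simps)
  qed
  then have "- (norm r)\<^sup>2 = 0" by (rule quadratic_nonneg_linear_zero)
  then have "M *v v = complex_of_real l *s v" by (simp add: r_def)
  with vv show ?thesis by (auto simp: W_def)
qed

lemma hermitian_eigenbasis:
  fixes M :: "complex ^ 'n::finite ^ 'n"
  assumes M: "hermitian M"
  shows "\<exists>\<phi> \<mu>. orthonormal_basis \<phi> \<and> (\<forall>i. M *v \<phi> i = complex_of_real (\<mu> i) *s \<phi> i)"
proof -
  \<comment> \<open>Partial eigenbases indexed by \<open>I\<close> are extended one index at a time;
    values outside \<open>I\<close> are unconstrained, so a new eigenvector is added by a function
    update.\<close>
  have "\<exists>\<phi> \<mu>. (\<forall>i\<in>I. \<forall>j\<in>I. cinner (\<phi> i) (\<phi> j) = (if i = j then 1 else 0))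
      \<and> (\<forall>i\<in>I. M *v \<phi> i = complex_of_real (\<mu> i) *s \<phi> i)" for I :: "'n set"
    using finite[of I]
  proof (induction I rule: finite_induct)
    case empty
    then show ?case by simp
  next
    case (insert k I)
    then obtain \<phi> \<mu> where o: "\<And>i j. i \<in> I \<Longrightarrow> j \<in> I \<Longrightarrow> cinner (\<phi> i) (\<phi> j) = (if i = j then 1 else 0)"
      and e: "\<And>i. i \<in> I \<Longrightarrow> M *v \<phi> i = complex_of_real (\<mu> i) *s \<phi> i" by blast
    obtain v l where v: "cinner v v = 1" "\<And>i. i \<in> I \<Longrightarrow> cinner (\<phi> i) v = 0"
        "M *v v = complex_of_real l *s v"
      using hermitian_eigenvector_orthogonal[where \<phi>=\<phi> and \<mu>=\<mu>, OF M insert.hyps(2) e] by blast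
    have "cinner v (\<phi> i) = 0" if "i \<in> I" for i
      using v(2)[OF that] by (metis cnj_cinner complex_cnj_zero)
    then show ?case
      using o e v insert.hyps(2)
      by (intro exI[of _ "\<phi>(k := v)"] exI[of _ "\<mu>(k := l)"]) auto
  qed
  from this[of UNIV] show ?thesis
    by (metis UNIV_I orthonormal_basisI)
qed

text \<open>The matrix \<open>X\<close>, that is x times the identity minus \<open>M\<close>, is
  diagonalized by the basis over the polynomial ring. Determinants then factor the characteristic
  polynomial, so algebraic multiplicities agree with repetitions in \<mu>.\<close>

lemma eigenvalues_eigenbasis:
  fixes M :: "complex ^ 'n::finite ^ 'n"
  assumes \<phi>: "orthonormal_basis \<phi>" and eig: "\<And>i. M *v \<phi> i = \<mu> i *s \<phi> i"
  shows "eigenvalues M = image_mset \<mu> (mset_set UNIV)"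
proof -
  define U where "U = (\<chi> r i. \<phi> i $ r)"
  \<comment> \<open>\<open>P\<close> embeds complex matrices multiplicatively as matrices of
    constant polynomials, which lets the basis change act on \<open>X\<close>.\<close>
  define P where "P A = (\<chi> i j. [:A $ i $ j:])" for A :: "complex ^ 'n ^ 'n"
  define D :: "complex poly ^ 'n ^ 'n" where "D = (\<chi> i j. if i = j then [:- \<mu> i, 1:] else 0)"
  define X :: "complex poly ^ 'n ^ 'n" where "X = (\<chi> i j. (if i = j then [:0, 1:] else 0) - [:M $ i $ j:])"
  have const_sum: "(\<Sum>k\<in>S. [:f k:]) = [:\<Sum>k\<in>S. f k:]" for f :: "'n \<Rightarrow> complex" and S
    by (induction S rule: infinite_finite_induct) auto
  have P_mult: "P A ** P B = P (A ** B)" for A B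
    by (simp add: P_def matrix_matrix_mult_def vec_eq_iff const_sum mult.commute)
  have U: "adj U ** U = mat 1"
    using orthonormal_resolution(1)[of \<phi>] \<phi> by (simp add: U_def orthonormal_basis_def)
  have "P (mat 1) = mat 1"
    by (simp add: P_def mat_def vec_eq_iff one_pCons)
  then have det1: "det (P (adj U)) * det (P U) = 1"
    by (metis P_mult U det_I det_mul)
  have eig': "(\<Sum>k\<in>UNIV. M $ i $ k * U $ k $ j) = \<mu> j * U $ i $ j" for i j
    using eig[of j] by (simp add: U_def matrix_vector_mult_def vec_eq_iff)
  have "(X ** P U) $ i $ j = (P U ** D) $ i $ j" for i j
  proof -
    have "(X ** P U) $ i $ j
        = (\<Sum>k\<in>UNIV. (if k = i then [:0, U $ k $ j:] else 0) - [:M $ i $ k * U $ k $ j:])"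
      by (auto simp: X_def P_def matrix_matrix_mult_def mult.commute intro!: sum.cong)
    also have "\<dots> = [:0, U $ i $ j:] - [:\<mu> j * U $ i $ j:]"
      using eig' by (simp only: sum_subtractf const_sum sum.delta finite UNIV_I if_True)
    also have "\<dots> = (\<Sum>k\<in>UNIV. if k = j then [:U $ i $ k:] * [:- \<mu> j, 1:] else 0)"
      by (simp add: mult.commute)
    also have "\<dots> = (P U ** D) $ i $ j"
      by (simp only: D_def P_def matrix_matrix_mult_def vec_lambda_beta) (intro sum.cong refl, simp)
    finally show ?thesis .
  qed
  then have "X ** P U = P U ** D"
    by (simp add: vec_eq_iff)
  then have XD: "det X * det (P U) = det (P U) * det D"
    by (metis det_mul)
  \<comment> \<open>Polynomials form no field, so \<open>det (P U)\<close> is cancelled by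
    multiplying with its explicit inverse \<open>det (P (adj U))\<close>.\<close>
  have "det X = (det X * det (P U)) * det (P (adj U))"
    using det1 by (simp add: mult.assoc mult.commute[of "det (P U)"])
  also have "\<dots> = det D * (det (P (adj U)) * det (P U))"
    unfolding XD by (simp only: ac_simps)
  also have "\<dots> = det D"
    by (simp only: det1 mult_1_right)
  also have "\<dots> = (\<Prod>i\<in>UNIV. [:- \<mu> i, 1:])"
    by (subst det_diagonal) (auto simp: D_def)
  finally have "charpoly M = (\<Prod>i\<in>UNIV. [:- \<mu> i, 1:])"
    by (simp add: charpoly_def X_def)
  moreover have "(\<Sum>i\<in>A. {#\<mu> i#}) = image_mset \<mu> (mset_set A)" for A
    by (induction A rule: infinite_finite_induct) auto
  ultimately show ?thesis
    by (simp add: eigenvalues_def proots_prod)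
qed

text \<open>Two enumerations of the same multiset differ by a permutation; reindexing an eigenbasis
  by it matches any prescribed listing \<beta>.\<close>

lemma hermitian_eigenbasis_eigenvalues:
  fixes M :: "complex ^ 'n::finite ^ 'n"
  assumes "hermitian M" and \<beta>: "eigenvalues M = image_mset \<beta> (mset_set UNIV)"
  shows "\<exists>\<phi>. orthonormal_basis \<phi> \<and> (\<forall>i. M *v \<phi> i = \<beta> i *s \<phi> i)"
proof -
  obtain \<phi> \<mu> where \<phi>: "orthonormal_basis \<phi>" and e: "\<And>i. M *v \<phi> i = complex_of_real (\<mu> i) *s \<phi> i"
    using hermitian_eigenbasis[OF assms(1)] by blast
  have "image_mset \<beta> (mset_set UNIV) = image_mset (\<lambda>i. complex_of_real (\<mu> i)) (mset_set UNIV)"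
    using \<beta> eigenvalues_eigenbasis[OF \<phi> e] by simp
  then obtain p where p: "p permutes UNIV" "\<And>i. \<beta> i = complex_of_real (\<mu> (p i))"
    using image_mset_eq_implies_permutes[of UNIV \<beta> "\<lambda>i. complex_of_real (\<mu> i)"] by auto
  have "orthonormal_basis (\<phi> \<circ> p)"
    using \<phi> permutes_inj[OF p(1)]
    by (intro orthonormal_basisI) (simp add: orthonormal_basis_def inj_eq)
  then show ?thesis
    using e p(2) by (intro exI[of _ "\<phi> \<circ> p"]) simp
qed

subsection \<open>The extracted energy as an expectation value\<close>

lemma sum_prod_UNIV:
  "(\<Sum>p\<in>(UNIV :: ('i::finite \<times> 'j::finite) set). f p) = (\<Sum>i\<in>UNIV. \<Sum>j\<in>UNIV. f (i, j))"
  by (simp add: sum.cartesian_product)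

lemma tensor_mult: "(A \<otimes>\<^sub>m B) ** (C \<otimes>\<^sub>m D) = (A ** C) \<otimes>\<^sub>m (B ** D)"
  by (simp add: tensor_def matrix_matrix_mult_def vec_eq_iff sum_prod_UNIV sum_product ac_simps)

lemma adj_tensor: "adj (A \<otimes>\<^sub>m B) = adj A \<otimes>\<^sub>m adj B"
  by (simp add: adj_def tensor_def vec_eq_iff)

lemma adj_mat: "adj (mat c) = mat (cnj c)"
  by (simp add: adj_def mat_def vec_eq_iff)

lemma adj_diff: "adj (A - B) = adj A - adj B"
  by (simp add: adj_def vec_eq_iff)

lemma adj_ptrace_fst: "adj (ptrace_fst M) = ptrace_fst (adj M)"
  by (simp add: adj_def ptrace_fst_def vec_eq_iff)

lemma ptrace_fst_diff: "ptrace_fst (A - B) = ptrace_fst A - ptrace_fst B"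
  by (simp add: ptrace_fst_def vec_eq_iff sum_subtractf)

text \<open>Cyclicity survives under a partial trace for a factor that acts only on the space traced
  out.\<close>

lemma ptrace_fst_commute: "ptrace_fst ((M \<otimes>\<^sub>m mat 1) ** N) = ptrace_fst (N ** (M \<otimes>\<^sub>m mat 1))"
proof -
  have "(\<Sum>k\<in>UNIV. \<Sum>l\<in>UNIV. M $ k $ l * N $ (l, i) $ (k, j))
      = (\<Sum>k\<in>UNIV. \<Sum>l\<in>UNIV. N $ (k, i) $ (l, j) * M $ l $ k)" for i j
    by (subst sum.swap) (simp add: mult.commute)
  then show ?thesis
    by (simp add: ptrace_fst_def tensor_def matrix_matrix_mult_def mat_def vec_eq_iff sum_prod_UNIV
        if_distrib if_distribR cong: if_cong)
qed

text \<open>Duality: the partial trace is adjoint, under the trace pairing, to tensoring with the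
  identity.\<close>

lemma trace_ptrace_fst:
  fixes M :: "complex ^ ('a::finite \<times> 'b::finite) ^ ('a \<times> 'b)"
  shows "trace (ptrace_fst M ** N) = trace (M ** (mat 1 \<otimes>\<^sub>m N))"
proof -
  \<comment> \<open>Pulls a condition free of the summation index out of the sum, so that the
    Kronecker deltas of \<open>mat 1\<close> collapse.\<close>
  have if_sum: "(\<Sum>j\<in>S. if b then f j else 0) = (if b then \<Sum>j\<in>S. f j else 0)"
    for b and S :: "'b set" and f :: "'b \<Rightarrow> complex"
    by simp
  have "trace (M ** (mat 1 \<otimes>\<^sub>m N)) = (\<Sum>k\<in>UNIV. \<Sum>i\<in>UNIV. \<Sum>j\<in>UNIV. M $ (k, i) $ (k, j) * N $ j $ i)"
    by (simp add: trace_def tensor_def matrix_matrix_mult_def mat_def sum_prod_UNIV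
        if_distrib if_distribR if_sum cong: if_cong)
  also have "\<dots> = (\<Sum>i\<in>UNIV. \<Sum>j\<in>UNIV. \<Sum>k\<in>UNIV. M $ (k, i) $ (k, j) * N $ j $ i)"
    by (subst sum.swap) (intro sum.cong refl sum.swap)
  finally show ?thesis
    by (simp add: trace_def ptrace_fst_def matrix_matrix_mult_def sum_distrib_right)
qed

lemma trace_ptrace_snd: "trace (M ** ptrace_snd N) = trace ((M \<otimes>\<^sub>m mat 1) ** N)"
proof -
  have "trace (M ** ptrace_snd N) = (\<Sum>i\<in>UNIV. \<Sum>j\<in>UNIV. \<Sum>k\<in>UNIV. M $ i $ j * N $ (j, k) $ (i, k))"
    by (simp add: trace_def ptrace_snd_def matrix_matrix_mult_def sum_distrib_left)
  also have "\<dots> = (\<Sum>i\<in>UNIV. \<Sum>k\<in>UNIV. \<Sum>j\<in>UNIV. M $ i $ j * N $ (j, k) $ (i, k))"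
    by (intro sum.cong refl sum.swap)
  also have "\<dots> = trace ((M \<otimes>\<^sub>m mat 1) ** N)"
    by (simp add: trace_def tensor_def matrix_matrix_mult_def mat_def sum_prod_UNIV
        if_distrib if_distribR cong: if_cong)
  finally show ?thesis .
qed

section \<open>Matrix identities and rank-one projections\<close>

lemma matrix_diff_ldistrib:
  fixes A :: "'c::ring_1 ^ 'n::finite ^ 'm"
  shows "A ** (B - C) = A ** B - A ** C"
  by (simp add: matrix_matrix_mult_def vec_eq_iff right_diff_distrib sum_subtractf)

lemma matrix_diff_rdistrib:
  fixes A :: "'c::ring_1 ^ 'n::finite ^ 'm"
  shows "(A - B) ** C = A ** C - B ** C"
  by (simp add: matrix_matrix_mult_def vec_eq_iff left_diff_distrib sum_subtractf)

lemma trace_mat_mult: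
  fixes M :: "'c::comm_ring_1 ^ 'n::finite ^ 'n"
  shows "trace (mat c ** M) = c * trace M"
  by (simp add: trace_def mat_def matrix_matrix_mult_def if_distrib if_distribR
      sum_distrib_left cong: if_cong)

lemma mat_mult_commute:
  fixes M :: "'c::comm_ring_1 ^ 'n::finite ^ 'n"
  shows "mat c ** M = M ** mat c"
  by (simp add: mat_def matrix_matrix_mult_def vec_eq_iff if_distrib if_distribR
      mult.commute cong: if_cong)

lemma trace_mult_ketbra: "trace (M ** ketbra v) = cinner v (M *v v)"
  by (simp add: trace_def ketbra_def matrix_matrix_mult_def cinner_def matrix_vector_mult_def
      sum_distrib_left ac_simps)

lemma ketbra_mult_ketbra: "ketbra u ** ketbra v = (\<chi> i j. cinner u v * (u $ i * cnj (v $ j)))"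
  by (simp add: ketbra_def matrix_matrix_mult_def cinner_def vec_eq_iff sum_distrib_left ac_simps)

lemma ketbra_idem:
  assumes "cinner v v = 1"
  shows "ketbra v ** ketbra v = ketbra v"
  using assms by (simp add: ketbra_mult_ketbra) (simp add: ketbra_def)

text \<open>Taking adjoints reverses the product of \<rho> and \<open>Z_op H \<rho>\<close>. The
  order is restored under the partial trace over B, since the scalar part of
  \<open>Z_op H \<rho>\<close> is central and the rest acts on B only. Self-adjointness of
  \<open>Z_op H \<rho>\<close> itself uses that the mean energy \<open>c\<close> is real.\<close>

lemma hermitian_B_op:
  assumes H: "hermitian H" and \<rho>: "hermitian \<rho>"
  shows "hermitian (B_op H \<rho>)"
proof -
  define c where "c = trace (ptrace_snd \<rho> ** H)"
  have "hermitian (ptrace_snd \<rho>)"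
    using \<rho> by (simp add: hermitian_def adj_ptrace_snd)
  then have "cnj c = c"
    using trace_mult_real[OF _ H] by (simp add: c_def Reals_cnj_iff)
  then have "adj (Z_op H \<rho>) = Z_op H \<rho>"
    using H by (simp add: Z_op_def c_def[symmetric] adj_diff adj_mat adj_tensor hermitian_def)
  then have "adj (B_op H \<rho>) = ptrace_fst (Z_op H \<rho> ** \<rho>)"
    using \<rho> by (simp add: B_op_def adj_ptrace_fst adj_mult hermitian_def)
  also have "\<dots> = B_op H \<rho>"
    by (simp add: B_op_def Z_op_def matrix_diff_ldistrib matrix_diff_rdistrib ptrace_fst_diff
        ptrace_fst_commute mat_mult_commute)
  finally show ?thesis by (simp add: hermitian_def)
qed

lemma outcome_energy_complex_expectation:
  fixes H :: "complex ^ 'b::finite ^ 'b"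
    and \<rho> :: "complex ^ ('b \<times> 'a::finite \<times> 'e::finite) ^ ('b \<times> 'a \<times> 'e)"
  assumes "cinner v v = 1"
  shows "outcome_energy_complex H \<rho> v = cinner v (B_op H \<rho> *v v)"
proof -
  define P :: "complex ^ ('b \<times> 'a \<times> 'e) ^ ('b \<times> 'a \<times> 'e)" where "P = mat 1 \<otimes>\<^sub>m ketbra v"
  define H1 :: "complex ^ ('b \<times> 'a \<times> 'e) ^ ('b \<times> 'a \<times> 'e)" where "H1 = H \<otimes>\<^sub>m mat 1"
  define c where "c = trace (ptrace_snd \<rho> ** H)"
  have PP: "P ** P = P"
    using assms by (simp add: P_def tensor_mult ketbra_idem)
  have HP: "H1 ** P = P ** H1"
    by (simp add: P_def H1_def tensor_mult)
  \<comment> \<open>Both energy terms have this shape, with \<open>A = mat c\<close> and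
    \<open>A = H1\<close>. As \<open>A\<close> commutes with the projection \<open>P\<close>, the
    two copies of \<open>P\<close> merge into one.\<close>
  have compress: "trace (A ** (P ** \<rho> ** P)) = trace (\<rho> ** A ** P)" if "A ** P = P ** A" for A
  proof -
    have "trace (A ** (P ** \<rho> ** P)) = trace (P ** A ** P ** \<rho>)"
      by (metis matrix_mul_assoc trace_mul_sym)
    also have "P ** A ** P ** \<rho> = A ** P ** \<rho>"
      by (metis PP matrix_mul_assoc that)
    also have "trace (A ** P ** \<rho>) = trace (\<rho> ** A ** P)"
      by (metis matrix_mul_assoc trace_mul_sym)
    finally show ?thesis .
  qed
  have "outcome_energy_complex H \<rho> v
      = trace (mat c ** (P ** \<rho> ** P)) - trace (H1 ** (P ** \<rho> ** P))"
    by (simp add: outcome_energy_complex_def post_state_def trace_ptrace_snd trace_mat_mult mult.commute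
        flip: P_def H1_def c_def)
  \<comment> \<open>The difference of the two choices of \<open>A\<close> is exactly
    \<open>Z_op H \<rho>\<close>; duality then moves the partial trace onto B and leaves
    \<open>ketbra v\<close> on AE.\<close>
  also have "\<dots> = trace (\<rho> ** Z_op H \<rho> ** P)"
    by (simp add: compress[OF HP] compress[OF mat_mult_commute] Z_op_def matrix_diff_ldistrib
        matrix_diff_rdistrib trace_sub flip: c_def H1_def)
  also have "\<dots> = cinner v (B_op H \<rho> *v v)"
    by (simp add: B_op_def P_def trace_mult_ketbra flip: trace_ptrace_fst)
  finally show ?thesis .
qed

subsection \<open>Optimal measurement bases\<close>

lemma expectation_eigenbasis:
  fixes M :: "complex ^ 'n::finite ^ 'n"
  assumes M: "hermitian M" and \<phi>: "orthonormal_basis \<phi>"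
    and eig: "\<And>i. M *v \<phi> i = complex_of_real (\<mu> i) *s \<phi> i"
  shows "Re (cinner v (M *v v)) = (\<Sum>i\<in>UNIV. \<mu> i * (cmod (cinner (\<phi> i) v))\<^sup>2)"
proof -
  have "cinner v (M *v v) = (\<Sum>i\<in>UNIV. cnj (cinner (\<phi> i) v) * cinner (\<phi> i) (M *v v))"
    using \<phi> by (simp add: orthonormal_parseval orthonormal_basis_def)
  also have "\<dots> = (\<Sum>i\<in>UNIV. complex_of_real (\<mu> i * (cmod (cinner (\<phi> i) v))\<^sup>2))"
    by (intro sum.cong refl)
      (simp add: hermitian_cinner[OF M] eig cinner_scale_left complex_norm_square del: of_real_power)
  finally show ?thesis by simp
qed

lemma cmod_cinner_commute: "cmod (cinner u v) = cmod (cinner v u)"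
  by (metis cnj_cinner complex_mod_cnj)

text \<open>After exchanging the sums, the weights for each fixed \<open>j\<close> add up to 1 by
  Parseval for \<open>\<phi> j\<close> in the basis \<psi>.\<close>

lemma sum_weighted_overlaps:
  fixes \<phi> \<psi> :: "'n::finite \<Rightarrow> complex ^ 'n"
  assumes \<phi>: "orthonormal_basis \<phi>" and \<psi>: "orthonormal_basis \<psi>"
  shows "(\<Sum>i\<in>UNIV. \<Sum>j\<in>UNIV. f j * (cmod (cinner (\<phi> j) (\<psi> i)))\<^sup>2) = (\<Sum>j\<in>UNIV. f j)"
proof -
  have "(\<Sum>i\<in>UNIV. (cmod (cinner (\<phi> j) (\<psi> i)))\<^sup>2) = 1" for j
    using orthonormal_cmod_sum[OF \<psi>, of "\<phi> j"] \<phi>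
    by (simp add: orthonormal_basis_self cmod_cinner_commute[of "\<phi> j"])
  then show ?thesis
    by (subst sum.swap) (simp flip: sum_distrib_left)
qed

lemma sum_expectations:
  fixes M :: "complex ^ 'n::finite ^ 'n"
  assumes M: "hermitian M" and \<phi>: "orthonormal_basis \<phi>"
    and eig: "\<And>i. M *v \<phi> i = complex_of_real (\<mu> i) *s \<phi> i"
    and \<psi>: "orthonormal_basis \<psi>"
  shows "(\<Sum>i\<in>UNIV. Re (cinner (\<psi> i) (M *v \<psi> i))) = (\<Sum>i\<in>UNIV. \<mu> i)"
  by (simp add: expectation_eigenbasis[OF M \<phi> eig] sum_weighted_overlaps[OF \<phi> \<psi>])

text \<open>Replacing \<mu> by its positive part makes all terms nonnegative, so the sum can be
  enlarged to all of \<psi>. The set \<open>I\<close> is arbitrary because the outcomes with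
  positive energy vary with the measurement basis.\<close>

lemma partial_sum_expectations_le:
  fixes M :: "complex ^ 'n::finite ^ 'n"
  assumes M: "hermitian M" and \<phi>: "orthonormal_basis \<phi>"
    and eig: "\<And>i. M *v \<phi> i = complex_of_real (\<mu> i) *s \<phi> i"
    and \<psi>: "orthonormal_basis \<psi>"
  shows "(\<Sum>i\<in>I. Re (cinner (\<psi> i) (M *v \<psi> i))) \<le> (\<Sum>j | \<mu> j > 0. \<mu> j)"
proof -
  have "(\<Sum>i\<in>I. Re (cinner (\<psi> i) (M *v \<psi> i)))
      \<le> (\<Sum>i\<in>I. \<Sum>j\<in>UNIV. max 0 (\<mu> j) * (cmod (cinner (\<phi> j) (\<psi> i)))\<^sup>2)"
    unfolding expectation_eigenbasis[OF M \<phi> eig] by (intro sum_mono mult_right_mono) auto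
  also have "\<dots> \<le> (\<Sum>i\<in>UNIV. \<Sum>j\<in>UNIV. max 0 (\<mu> j) * (cmod (cinner (\<phi> j) (\<psi> i)))\<^sup>2)"
    by (intro sum_mono2 sum_nonneg mult_nonneg_nonneg) auto
  also have "\<dots> = (\<Sum>j\<in>UNIV. max 0 (\<mu> j))"
    by (rule sum_weighted_overlaps[OF \<phi> \<psi>])
  also have "\<dots> = (\<Sum>j | \<mu> j > 0. \<mu> j)"
    by (intro sum.mono_neutral_cong_right) auto
  finally show ?thesis .
qed

text \<open>The expectation value is a convex combination of the eigenvalues.\<close>

lemma expectation_le_Max:
  fixes M :: "complex ^ 'n::finite ^ 'n"
  assumes M: "hermitian M" and \<phi>: "orthonormal_basis \<phi>"
    and eig: "\<And>i. M *v \<phi> i = complex_of_real (\<mu> i) *s \<phi> i"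
    and v: "cinner v v = 1"
  shows "Re (cinner v (M *v v)) \<le> Max (range \<mu>)"
proof -
  have "Re (cinner v (M *v v)) \<le> (\<Sum>i\<in>UNIV. Max (range \<mu>) * (cmod (cinner (\<phi> i) v))\<^sup>2)"
    unfolding expectation_eigenbasis[OF M \<phi> eig] by (intro sum_mono mult_right_mono) auto
  also have "\<dots> = Max (range \<mu>)"
    using orthonormal_cmod_sum[OF \<phi> v] by (simp flip: sum_distrib_left)
  finally show ?thesis .
qed

lemma greatest_elementI:
  fixes m :: real
  assumes "m \<in> X" "\<And>x. x \<in> X \<Longrightarrow> x \<le> m"
  shows "attains_max X \<and> (GREATEST x. x \<in> X) = m"
  using assms by (auto simp: attains_max_def intro: Greatest_equality)

text \<open>The listing \<beta> shares its index type with the measurement outcomes, so an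
  eigenbasis ordered by \<beta> is itself an admissible measurement. Eigenvalues are complex by
  type, hence reality is asserted along with the three values.\<close>

theorem theorem2:
  fixes H_B :: "complex ^ 'b::finite ^ 'b"
    and \<rho>_BAE :: "complex ^ ('b \<times> 'a::finite \<times> 'e::finite) ^ ('b \<times> 'a \<times> 'e)"
    and \<rho>_X :: "complex ^ 'x::finite ^ 'x"
    and \<rho>_S :: "complex ^ (('b \<times> 'a \<times> 'e) \<times> 'x) ^ (('b \<times> 'a \<times> 'e) \<times> 'x)"
    and \<beta> :: "'a \<times> 'e \<Rightarrow> complex"
  assumes "hermitian H_B"
    and "density_op \<rho>_BAE"
    and "density_op \<rho>_X"
    and "\<rho>_S = \<rho>_BAE \<otimes>\<^sub>m \<rho>_X"
    and "eigenvalues (B_op H_B \<rho>_BAE) = image_mset \<beta> (mset_set UNIV)"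
  shows "(\<forall>i. \<beta> i \<in> \<real>)
    \<and> attains_max (distillable_values H_B \<rho>_BAE)
    \<and> S_D H_B \<rho>_BAE = (\<Sum>i | Re (\<beta> i) > 0. Re (\<beta> i))
    \<and> attains_max (stochastic_values H_B \<rho>_BAE)
    \<and> S_max H_B \<rho>_BAE = Max (range (\<lambda>i. Re (\<beta> i)))
    \<and> attains_max (average_values H_B \<rho>_BAE)
    \<and> S_av H_B \<rho>_BAE = (\<Sum>i\<in>UNIV. Re (\<beta> i))"
proof -
  define M where "M = B_op H_B \<rho>_BAE"
  define \<mu> where "\<mu> i = Re (\<beta> i)" for i
  have M: "hermitian M"
    using assms(1,2) by (simp add: M_def hermitian_B_op density_op_def)
  obtain \<phi> where \<phi>: "orthonormal_basis \<phi>" and eig: "\<And>i. M *v \<phi> i = \<beta> i *s \<phi> i"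
    using hermitian_eigenbasis_eigenvalues[OF M assms(5)[folded M_def]] by blast
  have exp: "cinner (\<phi> i) (M *v \<phi> i) = \<beta> i" for i
    using \<phi> by (simp add: eig cinner_scale_right orthonormal_basis_self)
  \<comment> \<open>Each \<open>\<beta> i\<close> is an expectation value of the Hermitian
    \<open>M\<close>.\<close>
  then have real: "\<beta> i \<in> \<real>" for i
    by (metis hermitian_expectation_real[OF M])
  then have eig': "M *v \<phi> i = complex_of_real (\<mu> i) *s \<phi> i" for i
    by (simp add: eig \<mu>_def)
  have energy: "outcome_energy H_B \<rho>_BAE (\<psi> i) = Re (cinner (\<psi> i) (M *v \<psi> i))"
    if "orthonormal_basis \<psi>" for \<psi> i
    using that by (simp add: outcome_energy_def M_def outcome_energy_complex_expectation
        orthonormal_basis_self)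
  have energy_\<phi>: "outcome_energy H_B \<rho>_BAE (\<phi> i) = \<mu> i" for i
    by (simp add: energy[OF \<phi>] exp \<mu>_def)
  have D: "attains_max (distillable_values H_B \<rho>_BAE) \<and>
      (GREATEST x. x \<in> distillable_values H_B \<rho>_BAE) = (\<Sum>i | \<mu> i > 0. \<mu> i)"
  proof (rule greatest_elementI)
    show "(\<Sum>i | \<mu> i > 0. \<mu> i) \<in> distillable_values H_B \<rho>_BAE"
      unfolding distillable_values_def using \<phi> energy_\<phi> by (intro CollectI exI[of _ \<phi>]) simp
    \<comment> \<open>The index set in the partial-sum bound is here the set of outcomes with
      positive energy in the competing basis.\<close>
    show "x \<le> (\<Sum>i | \<mu> i > 0. \<mu> i)" if "x \<in> distillable_values H_B \<rho>_BAE" for x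
      using that partial_sum_expectations_le[OF M \<phi> eig']
      by (auto simp: distillable_values_def energy)
  qed
  have S: "attains_max (stochastic_values H_B \<rho>_BAE) \<and>
      (GREATEST x. x \<in> stochastic_values H_B \<rho>_BAE) = Max (range \<mu>)"
  proof (rule greatest_elementI)
    show "Max (range \<mu>) \<in> stochastic_values H_B \<rho>_BAE"
      unfolding stochastic_values_def using \<phi> energy_\<phi> by (intro CollectI exI[of _ \<phi>]) simp
    show "x \<le> Max (range \<mu>)" if mem: "x \<in> stochastic_values H_B \<rho>_BAE" for x
    proof -
      obtain \<psi> where \<psi>: "orthonormal_basis \<psi>"
        and x: "x = Max (range (\<lambda>i. outcome_energy H_B \<rho>_BAE (\<psi> i)))"
        using mem unfolding stochastic_values_def by blast
      have "outcome_energy H_B \<rho>_BAE (\<psi> i) \<le> Max (range \<mu>)" for i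
        using \<psi> unfolding energy[OF \<psi>]
        by (intro expectation_le_Max[OF M \<phi> eig']) (simp add: orthonormal_basis_self)
      then show ?thesis by (auto simp: x)
    qed
  qed
  have A: "attains_max (average_values H_B \<rho>_BAE) \<and>
      (GREATEST x. x \<in> average_values H_B \<rho>_BAE) = (\<Sum>i\<in>UNIV. \<mu> i)"
  proof (rule greatest_elementI)
    show "(\<Sum>i\<in>UNIV. \<mu> i) \<in> average_values H_B \<rho>_BAE"
      unfolding average_values_def using \<phi> energy_\<phi> by (intro CollectI exI[of _ \<phi>]) simp
    show "x \<le> (\<Sum>i\<in>UNIV. \<mu> i)" if "x \<in> average_values H_B \<rho>_BAE" for x
      using that sum_expectations[OF M \<phi> eig']
      by (auto simp: average_values_def energy)
  qed
  show ?thesis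
    using real D S A by (simp add: S_D_def S_max_def S_av_def \<mu>_def)
qed

end
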